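(* Consider the setting with $n\ge2$ decision makers described in the context. Let $i$ be an arbitrary decision maker, fix a round $t$, and suppose: (H1) $\mathcal{E}_t=\boldsymbol{\mathcal{E}}$ for a fixed matrix $\boldsymbol{\mathcal{E}}\in\mathbb{R}^{m\times d}$ common to all agents; (H2) $\gamma_{jt}=\gamma_j$ for constants $\gamma_j\ge0$ ($j=1,\dots,n$) common to all agents, and $Z_t$ is conditionally independent of $\{X_t,B_t\}$ given $\{W_{jt}\}_{j=1}^n$; (M1) $\mathrm{cBP}_i(\{\boldsymbol{\theta}_{it},\boldsymbol{\theta}_t^{-i}\})=g_i(\boldsymbol{\theta}_{it})+h_i(\boldsymbol{\theta}_t^{-i})+c_i$ for some functions $g_i,h_i$ and constant $c_i$; (M2) $g_i(\boldsymbol{\theta}_{it})=\boldsymbol{\alpha}_i^\top\boldsymbol{\theta}_{it}+\beta_i$ for some $\boldsymbol{\alpha}_i\in\mathbb{R}^m$, $\beta_i\in\mathbb{R}$; (M3) the admissible parameters satisfy $\|\boldsymbol{\theta}_{it}\|_2\le1$; and $\gamma_i>0$. Let $\boldsymbol{\theta}_i^{\mathrm{AO}}=\dfrac{\boldsymbol{\alpha}_i+\gamma_i\boldsymbol{\mathcal{E}}\boldsymbol{\mathcal{E}}^\top\boldsymbol{\theta}_i^*}{\|\boldsymbol{\alpha}_i+\gamma_i\boldsymbol{\mathcal{E}}\boldsymbol{\mathcal{E}}^\top\boldsymbol{\theta}_i^*\|_2}$ (assuming the denominator is nonzero). If $\boldsymbol{\alpha}_i=(k_i-\gamma_i)\boldsymbol{\mathcal{E}}\boldsymbol{\mathcal{E}}^\top\boldsymbol{\theta}_i^*$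 for some $k_i>0$, then, regardless of $\boldsymbol{\theta}_t^{-i}$, $\boldsymbol{\theta}_i^{\mathrm{AO}}$ maximises both $\mathcal{Q}_i(\{\boldsymbol{\theta}_{it},\boldsymbol{\theta}_t^{-i}\})$ and $\mathrm{cPI}_i(\{\boldsymbol{\theta}_{it},\boldsymbol{\theta}_t^{-i}\})$ over admissible $\boldsymbol{\theta}_{it}$.
   Context: Setting with $n$ decision makers (DMs). In round $t$ each DM $i$ publishes a parameter vector $\boldsymbol{\theta}_{it}\in\mathbb{R}^m$ and a selection rule $\boldsymbol{\delta}_{\boldsymbol{\theta}_{it}}:\mathbb{R}^m\to[0,1]$. Write $\boldsymbol{\theta}_t^{\mathrm{all}}=\{\boldsymbol{\theta}_{it},\boldsymbol{\theta}_t^{-i}\}=\{\boldsymbol{\theta}_{jt}\}_{j=1}^n$, where $\boldsymbol{\theta}_t^{-i}$ collects the parameters of all DMs other than $i$. An agent arrives with random baseline $B_t\in\mathbb{R}^m$, effort conversion matrix $\mathcal{E}_t\in\mathbb{R}^{m\times d}$ and real-valued noises $O_{it}$ (possibly correlated with $B_t$). If the agent takes action $\mathbf{a}\in\mathbb{R}^d$, its covariates are $X_t=B_t+\mathcal{E}_t\mathbf{a}$ and its predicted outcomes are $\hat y_{it}=X_t^\top\boldsymbol{\theta}_{it}$. The agent chooses the action maximising $\sum_{i}\gamma_{it}\hat y_{it}-\frac12\|\mathbf{a}\|_2^2$ (with $\gamma_{it}\ge0$), i.e. $\mathbf{a}_t=\mathcal{E}_t^\top\sum_{j=1}^n\gamma_{jt}\boldsymbol{\theta}_{jt}$.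 Selection statuses $W_{it}\in\{0,1\}$ satisfy $W_{it}\sim\mathrm{Bernoulli}(\boldsymbol{\delta}_{\boldsymbol{\theta}_{it}}(X_t))$ given $X_t$, and $Z_t\in\{0,1,\dots,n\}$ indicates the DM whose positive decision the agent complies with ($0$ if none). The potential outcome with DM $i$ is $Y_{it}=X_t^\top\boldsymbol{\theta}_i^*+O_{it}$, with $\boldsymbol{\theta}_i^*\in\mathbb{R}^m$ fixed. Conditional expectations given $Z_t=i$ are assumed well defined; "$;\boldsymbol{\theta}_t^{\mathrm{all}}$" indicates the distribution induced by deploying $\boldsymbol{\theta}_t^{\mathrm{all}}$. The objective of DM $i$ is $$\mathcal{Q}_i(\boldsymbol{\theta}_t^{\mathrm{all}})=\mathbb{E}[Y_{it}\mid Z_t=i;\boldsymbol{\theta}_t^{\mathrm{all}}]=\mathrm{cBP}_i(\boldsymbol{\theta}_t^{\mathrm{all}})+\mathrm{cPI}_i(\boldsymbol{\theta}_t^{\mathrm{all}}),$$ $$\mathrm{cBP}_i(\boldsymbol{\theta}_t^{\mathrm{all}})=\mathbb{E}[B_t^\top\boldsymbol{\theta}_i^*+O_{it}\mid Z_t=i;\boldsymbol{\theta}_t^{\mathrm{all}}],\qquad \mathrm{cPI}_i(\boldsymbol{\theta}_t^{\mathrm{all}})=\mathbb{E}[(\mathcal{E}_t\mathbf{a}_t)^\top\boldsymbol{\theta}_i^*\mid Z_t=i;\boldsymbol{\theta}_t^{\mathrm{all}}],$$ and when $\mathcal{E}_t=\boldsymbol{\mathcal{E}}$ and $\gamma_{jt}=\gamma_j$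 are constants, $\mathrm{cPI}_i(\boldsymbol{\theta}_t^{\mathrm{all}})=\big(\sum_{j=1}^n\gamma_j\boldsymbol{\theta}_{jt}\big)^\top\boldsymbol{\mathcal{E}}\boldsymbol{\mathcal{E}}^\top\boldsymbol{\theta}_i^*$. *)

theory Defs
  imports "HOL-Probability.Probability"
begin

text \<open>
  One round of the interaction. The decision makers (DMs) are the elements of \<open>'n\<close>, and a
  parameter profile of all DMs is a function \<open>'n \<Rightarrow> real ^ 'm\<close>. Everything lives on a single
  sample space: \<open>baseline\<close>, \<open>conv\<close> (effort conversion matrix), \<open>noise\<close> and \<open>weight\<close> (the
  \<open>\<gamma>\<close>'s) describe the arriving agent and do not depend on the deployed profile, whereas the
  selection statuses and the compliance indicator are random variables indexed by the profile.
  The law induced by deploying a profile \<open>\<theta>\<close> is thus the law of the variables at index \<open>\<theta>\<close>.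
  In \<open>comply\<close>, \<open>None\<close> means that the agent complies with no DM.
\<close>

record ('w, 'n, 'm, 'd) market =
  prob_sp :: "'w measure"
  baseline :: "'w \<Rightarrow> real ^ 'm"
  conv :: "'w \<Rightarrow> real ^ 'd ^ 'm"
  noise :: "'n \<Rightarrow> 'w \<Rightarrow> real"
  weight :: "'n \<Rightarrow> 'w \<Rightarrow> real"
  sel_rule :: "'n \<Rightarrow> real ^ 'm \<Rightarrow> real ^ 'm \<Rightarrow> real"
  selected :: "('n \<Rightarrow> real ^ 'm) \<Rightarrow> 'n \<Rightarrow> 'w \<Rightarrow> bool"
  comply :: "('n \<Rightarrow> real ^ 'm) \<Rightarrow> 'w \<Rightarrow> 'n option"
  coef :: "'n \<Rightarrow> real ^ 'm"
  admissible :: "'n \<Rightarrow> (real ^ 'm) set"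

definition admissible_profiles ::
  "('w, 'n, 'm::finite, 'd::finite) market \<Rightarrow> ('n \<Rightarrow> real ^ 'm) set" where
  "admissible_profiles S = {\<theta>. \<forall>j. \<theta> j \<in> admissible S j}"

text \<open>The parameters of all DMs other than \<open>i\<close>, independent of \<open>\<theta> i\<close>.\<close>

definition rivals :: "'n \<Rightarrow> ('n \<Rightarrow> real ^ 'm) \<Rightarrow> ('n \<Rightarrow> real ^ 'm::finite)" where
  "rivals i \<theta> = restrict \<theta> (- {i})"

definition covariates_of ::
  "('w, 'n, 'm::finite, 'd::finite) market \<Rightarrow> 'w \<Rightarrow> real ^ 'd \<Rightarrow> real ^ 'm" where
  "covariates_of S \<omega> a = baseline S \<omega> + conv S \<omega> *v a"

definition agent_utility ::
  "('w, 'n::finite, 'm::finite, 'd::finite) market \<Rightarrow> ('n \<Rightarrow> real ^ 'm) \<Rightarrow> 'w \<Rightarrow> real ^ 'd \<Rightarrow> real"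
  where
  "agent_utility S \<theta> \<omega> a =
     (\<Sum>j\<in>UNIV. weight S j \<omega> * (covariates_of S \<omega> a \<bullet> \<theta> j)) - (norm a)\<^sup>2 / 2"

definition action ::
  "('w, 'n::finite, 'm::finite, 'd::finite) market \<Rightarrow> ('n \<Rightarrow> real ^ 'm) \<Rightarrow> 'w \<Rightarrow> real ^ 'd" where
  "action S \<theta> \<omega> = arg_max (agent_utility S \<theta> \<omega>) (\<lambda>_. True)"

lemma action_eq:
  "action S \<theta> \<omega> = transpose (conv S \<omega>) *v (\<Sum>j\<in>UNIV. weight S j \<omega> *\<^sub>R \<theta> j)"
proof -
  define s where "s = (\<Sum>j\<in>UNIV. weight S j \<omega> *\<^sub>R \<theta> j)"
  define v where "v = transpose (conv S \<omega>) *v s"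
  have u: "agent_utility S \<theta> \<omega> a = baseline S \<omega> \<bullet> s + (norm v)\<^sup>2 / 2 - (norm (a - v))\<^sup>2 / 2" for a
  proof -
    have "(\<Sum>j\<in>UNIV. weight S j \<omega> * (covariates_of S \<omega> a \<bullet> \<theta> j)) = covariates_of S \<omega> a \<bullet> s"
      by (simp add: s_def inner_sum_right)
    also have "\<dots> = baseline S \<omega> \<bullet> s + a \<bullet> v"
      using dot_lmul_matrix[of s "conv S \<omega>" a]
      by (simp add: covariates_of_def v_def inner_add_left inner_commute[of a]
          inner_commute[of "conv S \<omega> *v a"])
    finally show ?thesis
      by (simp add: agent_utility_def power2_norm_eq_inner inner_diff_left inner_diff_right
          inner_commute field_simps)
  qed
  have "is_arg_max (agent_utility S \<theta> \<omega>) (\<lambda>_. True) v"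
    by (simp add: is_arg_max_def u)
  then have "is_arg_max (agent_utility S \<theta> \<omega>) (\<lambda>_. True) (action S \<theta> \<omega>)"
    unfolding action_def arg_max_def by (rule someI)
  then have "\<not> agent_utility S \<theta> \<omega> v > agent_utility S \<theta> \<omega> (action S \<theta> \<omega>)"
    by (simp add: is_arg_max_def)
  then have "(norm (action S \<theta> \<omega> - v))\<^sup>2 \<le> 0"
    by (simp add: u)
  then show ?thesis
    by (simp add: v_def s_def)
qed

definition covariates ::
  "('w, 'n::finite, 'm::finite, 'd::finite) market \<Rightarrow> ('n \<Rightarrow> real ^ 'm) \<Rightarrow> 'w \<Rightarrow> real ^ 'm" where
  "covariates S \<theta> \<omega> = covariates_of S \<omega> (action S \<theta> \<omega>)"

definition outcome ::
  "('w, 'n::finite, 'm::finite, 'd::finite) market \<Rightarrow> 'n \<Rightarrow> ('n \<Rightarrow> real ^ 'm) \<Rightarrow> 'w \<Rightarrow> real" where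
  "outcome S i \<theta> \<omega> = covariates S \<theta> \<omega> \<bullet> coef S i + noise S i \<omega>"

definition base_outcome ::
  "('w, 'n, 'm::finite, 'd::finite) market \<Rightarrow> 'n \<Rightarrow> 'w \<Rightarrow> real" where
  "base_outcome S i \<omega> = baseline S \<omega> \<bullet> coef S i + noise S i \<omega>"

definition improvement ::
  "('w, 'n::finite, 'm::finite, 'd::finite) market \<Rightarrow> 'n \<Rightarrow> ('n \<Rightarrow> real ^ 'm) \<Rightarrow> 'w \<Rightarrow> real" where
  "improvement S i \<theta> \<omega> = (conv S \<omega> *v action S \<theta> \<omega>) \<bullet> coef S i"

text \<open>
  The conditional law given that the agent complies with DM \<open>i\<close>; it is a probability measure when
  this event has positive probability, as demanded in \<open>cond_means_defined\<close> below.
\<close>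

definition cond_law ::
  "('w, 'n, 'm::finite, 'd::finite) market \<Rightarrow> 'n \<Rightarrow> ('n \<Rightarrow> real ^ 'm) \<Rightarrow> 'w measure" where
  "cond_law S i \<theta> = uniform_measure (prob_sp S) {\<omega> \<in> space (prob_sp S). comply S \<theta> \<omega> = Some i}"

definition objective ::
  "('w, 'n::finite, 'm::finite, 'd::finite) market \<Rightarrow> 'n \<Rightarrow> ('n \<Rightarrow> real ^ 'm) \<Rightarrow> real" where
  "objective S i \<theta> = (\<integral>\<omega>. outcome S i \<theta> \<omega> \<partial>cond_law S i \<theta>)"

definition cBP ::
  "('w, 'n, 'm::finite, 'd::finite) market \<Rightarrow> 'n \<Rightarrow> ('n \<Rightarrow> real ^ 'm) \<Rightarrow> real" where
  "cBP S i \<theta> = (\<integral>\<omega>. base_outcome S i \<omega> \<partial>cond_law S i \<theta>)"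

definition cPI ::
  "('w, 'n::finite, 'm::finite, 'd::finite) market \<Rightarrow> 'n \<Rightarrow> ('n \<Rightarrow> real ^ 'm) \<Rightarrow> real" where
  "cPI S i \<theta> = (\<integral>\<omega>. improvement S i \<theta> \<omega> \<partial>cond_law S i \<theta>)"

definition cond_means_defined ::
  "('w, 'n::finite, 'm::finite, 'd::finite) market \<Rightarrow> 'n \<Rightarrow> bool" where
  "cond_means_defined S i \<longleftrightarrow> (\<forall>\<theta>\<in>admissible_profiles S.
     measure (prob_sp S) {\<omega> \<in> space (prob_sp S). comply S \<theta> \<omega> = Some i} > 0 \<and>
     integrable (cond_law S i \<theta>) (outcome S i \<theta>) \<and>
     integrable (cond_law S i \<theta>) (base_outcome S i) \<and>
     integrable (cond_law S i \<theta>) (improvement S i \<theta>))"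

text \<open>
  The equation for \<open>real_cond_exp\<close> says that, conditionally on the covariates, the selection by
  DM \<open>j\<close> is a Bernoulli variable with success probability \<open>sel_rule S j (\<theta> j)\<close> of the covariates.
\<close>

definition valid_market :: "('w, 'n::finite, 'm::finite, 'd::finite) market \<Rightarrow> bool" where
  "valid_market S \<longleftrightarrow>
     prob_space (prob_sp S) \<and>
     baseline S \<in> borel_measurable (prob_sp S) \<and>
     conv S \<in> borel_measurable (prob_sp S) \<and>
     (\<forall>j. noise S j \<in> borel_measurable (prob_sp S)) \<and>
     (\<forall>j. weight S j \<in> borel_measurable (prob_sp S)) \<and>
     (\<forall>j. AE \<omega> in prob_sp S. 0 \<le> weight S j \<omega>) \<and>
     (\<forall>j. \<forall>\<theta>\<in>admissible S j. sel_rule S j \<theta> \<in> borel_measurable borel \<and>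
        (\<forall>x. sel_rule S j \<theta> x \<in> {0..1})) \<and>
     (\<forall>\<theta>\<in>admissible_profiles S.
        comply S \<theta> \<in> measurable (prob_sp S) (count_space UNIV) \<and>
        (\<forall>j. selected S \<theta> j \<in> measurable (prob_sp S) (count_space UNIV)) \<and>
        (\<forall>j. AE \<omega> in prob_sp S.
           real_cond_exp (prob_sp S) (vimage_algebra (space (prob_sp S)) (covariates S \<theta>) borel)
             (\<lambda>\<omega>'. of_bool (selected S \<theta> j \<omega>')) \<omega>
           = sel_rule S j (\<theta> j) (covariates S \<theta> \<omega>)) \<and>
        (\<forall>j. AE \<omega> in prob_sp S. comply S \<theta> \<omega> = Some j \<longrightarrow> selected S \<theta> j \<omega>))"

text \<open>
  Conditional independence of the compliance indicator and (covariates, baseline) given the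
  finitely-valued vector of selection statuses: independence under the conditional law given each
  value \<open>w\<close> of that vector having positive probability. It is stated for the generated
  \<open>\<sigma>\<close>-algebras because \<open>indep_var\<close> wants two variables of the same type.
\<close>

definition comply_cond_indep ::
  "('w, 'n::finite, 'm::finite, 'd::finite) market \<Rightarrow> ('n \<Rightarrow> real ^ 'm) \<Rightarrow> bool" where
  "comply_cond_indep S \<theta> \<longleftrightarrow> (\<forall>w :: 'n \<Rightarrow> bool.
     let A = {\<omega> \<in> space (prob_sp S). \<forall>j. selected S \<theta> j \<omega> = w j} in
     measure (prob_sp S) A > 0 \<longrightarrow>
     prob_space.indep_set (uniform_measure (prob_sp S) A)
       (sets (vimage_algebra (space (prob_sp S)) (comply S \<theta>) (count_space UNIV)))
       (sets (vimage_algebra (space (prob_sp S))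
          (\<lambda>\<omega>. (covariates S \<theta> \<omega>, baseline S \<omega>)) borel)))"

end

theory Submission
  imports Defs
begin

text \<open>
  Each DM's own parameter enters \<open>cPI\<close> only through \<open>\<gamma> i * (\<theta> i \<bullet> v)\<close>, where
  \<open>v = (\<E> ** transpose \<E>) *v coef S i\<close>, and enters \<open>cBP\<close> only through \<open>\<alpha> \<bullet> \<theta> i\<close>. When \<open>\<alpha>\<close> is the
  multiple \<open>k - \<gamma> i\<close> of \<open>v\<close>, both \<open>cPI\<close> and the sum \<open>cBP + cPI\<close> are therefore increasing affine
  functions of the single number \<open>v \<bullet> \<theta> i\<close>, which over the unit ball is largest at \<open>v /\<^sub>R norm v\<close>.
\<close>

text \<open>The adjoint identity \<open>dot_lmul_matrix\<close> moves \<open>A\<close> across the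
  inner product twice. The action is written \<open>x v* A\<close> because simp normalises
  \<open>transpose A *v x\<close> to that form.\<close>

lemma inner_matrix_transpose_vector:
  fixes A :: "real ^ 'd::finite ^ 'm::finite"
  shows "(A *v (x v* A)) \<bullet> y = x \<bullet> ((A ** transpose A) *v y)"
proof -
  have "(A *v (x v* A)) \<bullet> y = (y v* A) \<bullet> (x v* A)"
    using dot_lmul_matrix[of y A "x v* A"] by (simp add: inner_commute)
  also have "\<dots> = x \<bullet> (A *v (y v* A))"
    using dot_lmul_matrix[of x A "y v* A"] by (simp add: inner_commute)
  finally show ?thesis
    by (simp add: matrix_vector_mul_assoc[symmetric])
qed

text \<open>Cauchy-Schwarz bounds \<open>v \<bullet> x\<close> by \<open>norm v\<close> on the ball,
  with equality at the normalised \<open>v\<close>; a nonnegative slope preserves the order. The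
  formula for \<open>f\<close> is required only inside the ball, since the market quantities are
  controlled only at admissible profiles.\<close>

lemma is_arg_max_affine_unit_ball:
  fixes v :: "'a::real_inner"
  assumes "v \<noteq> 0" and "a \<ge> 0"
    and f: "\<And>x. norm x \<le> 1 \<Longrightarrow> f x = a * (v \<bullet> x) + (b::real)"
  shows "is_arg_max f (\<lambda>x. norm x \<le> 1) (v /\<^sub>R norm v)"
proof -
  have unit: "norm (v /\<^sub>R norm v) = 1"
    using \<open>v \<noteq> 0\<close> by simp
  have max: "v \<bullet> (v /\<^sub>R norm v) = norm v"
    using \<open>v \<noteq> 0\<close> by (simp add: dot_square_norm power2_eq_square)
  have "f x \<le> f (v /\<^sub>R norm v)" if "norm x \<le> 1" for x
  proof -
    have "v \<bullet> x \<le> norm v * norm x"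
      by (rule norm_cauchy_schwarz)
    also have "\<dots> \<le> norm v"
      using that by (simp add: mult_left_le)
    finally have "a * (v \<bullet> x) \<le> a * norm v"
      using \<open>a \<ge> 0\<close> by (rule mult_left_mono)
    then show ?thesis
      using that unit max f by simp
  qed
  then show ?thesis
    using unit by (auto simp: is_arg_max_linorder)
qed

lemma compliance_event_sets:
  assumes "valid_market S" and "\<theta> \<in> admissible_profiles S"
  shows "{\<omega> \<in> space (prob_sp S). comply S \<theta> \<omega> = Some i} \<in> sets (prob_sp S)"
proof -
  have "comply S \<theta> \<in> measurable (prob_sp S) (count_space UNIV)"
    using assms by (auto simp: valid_market_def)
  from measurable_sets[OF this, of "{Some i}"] show ?thesis
    by (simp add: vimage_def Int_def conj_commute)
qed

text \<open>The compliance event has positive probability, so conditioning on it gives a genuine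
  probability measure whose null sets include those of \<open>prob_sp S\<close>.\<close>

lemma
  assumes "valid_market S" and "cond_means_defined S i" and "\<theta> \<in> admissible_profiles S"
  shows prob_space_cond_law: "prob_space (cond_law S i \<theta>)"
    and AE_cond_lawI: "AE \<omega> in prob_sp S. P \<omega> \<Longrightarrow> AE \<omega> in cond_law S i \<theta>. P \<omega>"
proof -
  define A where "A = {\<omega> \<in> space (prob_sp S). comply S \<theta> \<omega> = Some i}"
  interpret prob_space "prob_sp S"
    using assms by (simp add: valid_market_def)
  have A: "A \<in> events"
    unfolding A_def using assms by (intro compliance_event_sets)
  have "emeasure (prob_sp S) A \<noteq> 0"
    using assms by (auto simp: cond_means_defined_def A_def emeasure_eq_measure)
  then show "prob_space (cond_law S i \<theta>)"
    unfolding cond_law_def A_def[symmetric] by (rule prob_space_uniform_measure) simp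
  show "AE \<omega> in cond_law S i \<theta>. P \<omega>" if "AE \<omega> in prob_sp S. P \<omega>"
    unfolding cond_law_def A_def[symmetric] using A that by (intro AE_uniform_measureI) auto
qed

text \<open>The outcome splits pointwise into a baseline and an effort part; integrability of both
  lets the conditional expectation split as well.\<close>

lemma objective_eq:
  assumes "cond_means_defined S i" and "\<theta> \<in> admissible_profiles S"
  shows "objective S i \<theta> = cBP S i \<theta> + cPI S i \<theta>"
proof -
  have "outcome S i \<theta> = (\<lambda>\<omega>. base_outcome S i \<omega> + improvement S i \<theta> \<omega>)"
    by (simp add: fun_eq_iff outcome_def base_outcome_def improvement_def covariates_def
        covariates_of_def inner_add_left)
  then show ?thesis
    using assms by (simp add: objective_def cBP_def cPI_def cond_means_defined_def)
qed

text \<open>With conversion matrix and weights almost surely constant, the improvement is itself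
  almost surely constant. Its conditional mean is that constant, however the profile shapes the
  compliance event.\<close>

lemma cPI_eq:
  fixes S :: "('w, 'n::finite, 'm::finite, 'd::finite) market"
  assumes S: "valid_market S" "cond_means_defined S i" and \<theta>: "\<theta> \<in> admissible_profiles S"
    and conv: "AE \<omega> in prob_sp S. conv S \<omega> = \<E>"
    and weight: "\<And>j. AE \<omega> in prob_sp S. weight S j \<omega> = \<gamma> j"
  shows "cPI S i \<theta> = (\<Sum>j\<in>UNIV. \<gamma> j *\<^sub>R \<theta> j) \<bullet> ((\<E> ** transpose \<E>) *v coef S i)"
    (is "_ = ?c")
proof -
  interpret cond: prob_space "cond_law S i \<theta>"
    using S \<theta> by (rule prob_space_cond_law)
  \<comment> \<open>There are finitely many DMs, so their exceptional null sets merge into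
    one.\<close>
  have "AE \<omega> in prob_sp S. \<forall>j. weight S j \<omega> = \<gamma> j"
    using weight by (simp add: AE_all_countable)
  with conv have "AE \<omega> in prob_sp S. improvement S i \<theta> \<omega> = ?c"
    by eventually_elim (simp add: improvement_def action_eq inner_matrix_transpose_vector)
  then have "AE \<omega> in cond_law S i \<theta>. improvement S i \<theta> \<omega> = ?c"
    by (rule AE_cond_lawI[OF S \<theta>])
  moreover have "improvement S i \<theta> \<in> borel_measurable (cond_law S i \<theta>)"
    using S \<theta> by (auto simp: cond_means_defined_def)
  ultimately have "cPI S i \<theta> = (\<integral>\<omega>. ?c \<partial>cond_law S i \<theta>)"
    unfolding cPI_def by (intro integral_cong_AE) auto
  then show ?thesis
    by (simp add: cond.prob_space)
qed

theorem corollary3p6: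
  fixes S :: "('w, 'n::finite, 'm::finite, 'd::finite) market"
    and i :: 'n
    and \<E> :: "real ^ 'd ^ 'm"
    and \<gamma> :: "'n \<Rightarrow> real"
    and g :: "real ^ 'm \<Rightarrow> real"
    and h :: "('n \<Rightarrow> real ^ 'm) \<Rightarrow> real"
    and c \<beta> k :: real
    and \<alpha> \<theta>_AO :: "real ^ 'm"
  assumes n: "CARD('n) \<ge> 2"
    and setting: "valid_market S"
    and well_defined: "cond_means_defined S i"
    and H1: "AE \<omega> in prob_sp S. conv S \<omega> = \<E>"
    and H2_weights: "\<And>j. AE \<omega> in prob_sp S. weight S j \<omega> = \<gamma> j"
    and H2_nonneg: "\<And>j. \<gamma> j \<ge> 0"
    and H2_indep: "\<And>\<theta>. \<theta> \<in> admissible_profiles S \<Longrightarrow> comply_cond_indep S \<theta>"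
    and M1: "\<And>\<theta>. \<theta> \<in> admissible_profiles S \<Longrightarrow> cBP S i \<theta> = g (\<theta> i) + h (rivals i \<theta>) + c"
    and M2: "\<And>x. x \<in> admissible S i \<Longrightarrow> g x = \<alpha> \<bullet> x + \<beta>"
    and M3: "admissible S i = {x. norm x \<le> 1}"
    and \<gamma>_pos: "\<gamma> i > 0"
    and nonzero: "norm (\<alpha> + \<gamma> i *\<^sub>R ((\<E> ** transpose \<E>) *v coef S i)) \<noteq> 0"
    and \<theta>_AO: "\<theta>_AO = (\<alpha> + \<gamma> i *\<^sub>R ((\<E> ** transpose \<E>) *v coef S i)) /\<^sub>R
                  norm (\<alpha> + \<gamma> i *\<^sub>R ((\<E> ** transpose \<E>) *v coef S i))"
    and k_pos: "k > 0"
    and \<alpha>: "\<alpha> = (k - \<gamma> i) *\<^sub>R ((\<E> ** transpose \<E>) *v coef S i)"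
  shows "\<forall>\<theta>. (\<forall>j. j \<noteq> i \<longrightarrow> \<theta> j \<in> admissible S j) \<longrightarrow>
           is_arg_max (\<lambda>x. objective S i (\<theta>(i := x))) (\<lambda>x. x \<in> admissible S i) \<theta>_AO \<and>
           is_arg_max (\<lambda>x. cPI S i (\<theta>(i := x))) (\<lambda>x. x \<in> admissible S i) \<theta>_AO"
proof (intro allI impI)
  fix \<theta> assume others: "\<forall>j. j \<noteq> i \<longrightarrow> \<theta> j \<in> admissible S j"
  define v where "v = (\<E> ** transpose \<E>) *v coef S i"
  \<comment> \<open>The coefficient \<open>k - \<gamma> i\<close> in \<alpha> is what makes the sum
    collapse to \<open>k *\<^sub>R v\<close>; as \<open>k\<close> is positive, normalising then
    cancels it.\<close>
  have dir: "\<alpha> + \<gamma> i *\<^sub>R v = k *\<^sub>R v"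
    by (simp add: \<alpha> v_def scaleR_left_diff_distrib)
  have AO: "\<theta>_AO = v /\<^sub>R norm v"
    using k_pos by (simp add: \<theta>_AO v_def[symmetric] dir)
  have "v \<noteq> 0"
    using nonzero by (auto simp: v_def[symmetric] dir)
  \<comment> \<open>The rivals' share of \<open>cPI\<close>, constant in the own parameter
    \<open>x\<close>.\<close>
  define r where "r = (\<Sum>j\<in>- {i}. \<gamma> j *\<^sub>R \<theta> j) \<bullet> v"
  \<comment> \<open>Nothing is known about \<open>\<theta> i\<close>, but the update overwrites
    it.\<close>
  have adm: "\<theta>(i := x) \<in> admissible_profiles S" if "norm x \<le> 1" for x
    using others that by (simp add: admissible_profiles_def M3)
  have PI: "cPI S i (\<theta>(i := x)) = \<gamma> i * (v \<bullet> x) + r" if "norm x \<le> 1" for x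
  proof -
    have "(\<Sum>j\<in>UNIV. \<gamma> j *\<^sub>R (\<theta>(i := x)) j)
        = \<gamma> i *\<^sub>R x + (\<Sum>j\<in>- {i}. \<gamma> j *\<^sub>R (\<theta>(i := x)) j)"
      by (simp add: sum.remove[of UNIV i] Compl_eq_Diff_UNIV)
    also have "(\<Sum>j\<in>- {i}. \<gamma> j *\<^sub>R (\<theta>(i := x)) j) = (\<Sum>j\<in>- {i}. \<gamma> j *\<^sub>R \<theta> j)"
      by (intro sum.cong) auto
    finally have "(\<Sum>j\<in>UNIV. \<gamma> j *\<^sub>R (\<theta>(i := x)) j) \<bullet> v = \<gamma> i * (v \<bullet> x) + r"
      by (simp only: inner_add_left inner_scaleR_left r_def inner_commute[of x])
    then show ?thesis
      using cPI_eq[OF setting well_defined adm[OF that] H1 H2_weights] by (simp add: v_def)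
  qed
  have obj: "objective S i (\<theta>(i := x)) = k * (v \<bullet> x) + (\<beta> + h (rivals i \<theta>) + c + r)"
    if "norm x \<le> 1" for x
  proof -
    \<comment> \<open>Hence the \<open>h\<close> term of \<open>cBP\<close> does not vary with
      \<open>x\<close>.\<close>
    have "rivals i (\<theta>(i := x)) = rivals i \<theta>"
      by (auto simp: rivals_def restrict_def)
    then have "cBP S i (\<theta>(i := x)) = \<alpha> \<bullet> x + \<beta> + h (rivals i \<theta>) + c"
      using M1[OF adm[OF that]] M2[of x] that by (simp add: M3)
    \<comment> \<open>The slopes \<open>k - \<gamma> i\<close> from \<open>cBP\<close> and
      \<open>\<gamma> i\<close> from \<open>cPI\<close> add up to \<open>k\<close>, even when the
      former is negative.\<close>
    moreover have "\<alpha> \<bullet> x + \<gamma> i * (v \<bullet> x) = k * (v \<bullet> x)"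
      using dir by (metis inner_add_left inner_scaleR_left)
    ultimately show ?thesis
      by (simp add: objective_eq[OF well_defined adm[OF that]] PI[OF that])
  qed
  have "is_arg_max (\<lambda>x. objective S i (\<theta>(i := x))) (\<lambda>x. norm x \<le> 1) \<theta>_AO"
    unfolding AO using \<open>v \<noteq> 0\<close> k_pos by (intro is_arg_max_affine_unit_ball[OF _ _ obj]) auto
  moreover have "is_arg_max (\<lambda>x. cPI S i (\<theta>(i := x))) (\<lambda>x. norm x \<le> 1) \<theta>_AO"
    unfolding AO using \<open>v \<noteq> 0\<close> \<gamma>_pos by (intro is_arg_max_affine_unit_ball[OF _ _ PI]) auto
  ultimately show "is_arg_max (\<lambda>x. objective S i (\<theta>(i := x))) (\<lambda>x. x \<in> admissible S i) \<theta>_AO \<and>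
      is_arg_max (\<lambda>x. cPI S i (\<theta>(i := x))) (\<lambda>x. x \<in> admissible S i) \<theta>_AO"
    by (simp add: M3)
qed

end
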